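(* There is a bijection between spanning trees of the complete split graph $S_{m,n}$ and pairs of words $(\mathsf{f},\mathsf{g})$ such that $\mathsf{f}$ has length $m-1$ and has letters in the alphabet $\{v_1,\ldots,v_{m+n}\}$, while $\mathsf{g}$ has $n-1$ letters in the alphabet $\{v_1,\ldots,v_m\}$.
   Context: The complete split graph $S_{m,n}$ here has clique vertices $v_1,\ldots,v_m$ and independent vertices $v_{m+1},\ldots,v_{m+n}$. Every two distinct clique vertices are joined by a single edge, every clique vertex is joined to every independent vertex by precisely one edge, and no two independent vertices are adjacent. Spanning trees are trees on the labelled vertex set $\{v_1,\ldots,v_{m+n}\}$ all of whose edges are edges of $S_{m,n}$. A word is a finite sequence of letters, with repetitions allowed. *)

theory Defs
  imports Main
begin

text \<open>
  Undirected simple graphs are given by a vertex set \<open>V\<close> and a set \<open>E\<close> of two-element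
  subsets of \<open>V\<close>.
\<close>

definition simple_graph :: "'a set \<Rightarrow> 'a set set \<Rightarrow> bool" where
  "simple_graph V E \<longleftrightarrow> (\<forall>e\<in>E. \<exists>u\<in>V. \<exists>v\<in>V. u \<noteq> v \<and> e = {u, v})"

definition connected_graph :: "'a set \<Rightarrow> 'a set set \<Rightarrow> bool" where
  "connected_graph V E \<longleftrightarrow>
     V \<noteq> {} \<and> (\<forall>u\<in>V. \<forall>v\<in>V. (u, v) \<in> {(x, y). {x, y} \<in> E}\<^sup>*)"

text \<open>A cycle is listed without repeating its first vertex at the end.\<close>

definition graph_cycle :: "'a set set \<Rightarrow> 'a list \<Rightarrow> bool" where
  "graph_cycle E c \<longleftrightarrow>
     3 \<le> length c \<and> distinct c \<and>
     (\<forall>i. Suc i < length c \<longrightarrow> {c ! i, c ! Suc i} \<in> E) \<and> {last c, hd c} \<in> E"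

definition is_tree :: "'a set \<Rightarrow> 'a set set \<Rightarrow> bool" where
  "is_tree V E \<longleftrightarrow> simple_graph V E \<and> connected_graph V E \<and> (\<nexists>c. graph_cycle E c)"

text \<open>A spanning tree has vertex set \<open>V\<close>, so it is identified with its edge set \<open>T\<close>.\<close>

definition spanning_trees :: "'a set \<Rightarrow> 'a set set \<Rightarrow> 'a set set set" where
  "spanning_trees V E = {T. T \<subseteq> E \<and> is_tree V T}"

text \<open>
  The vertex \<open>v\<^sub>i\<close> of the complete split graph is represented by its index \<open>i\<close>: the clique
  vertices are \<open>{1..m}\<close>, the independent ones \<open>{m+1..m+n}\<close>.
\<close>

definition split_verts :: "nat \<Rightarrow> nat \<Rightarrow> nat set" where
  "split_verts m n = {1..m + n}"

definition split_edges :: "nat \<Rightarrow> nat \<Rightarrow> nat set set" where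
  "split_edges m n =
     {{i, j} | i j. i \<in> {1..m} \<and> j \<in> {1..m} \<and> i \<noteq> j} \<union>
     {{i, j} | i j. i \<in> {1..m} \<and> j \<in> {m + 1..m + n}}"

definition words :: "'a set \<Rightarrow> nat \<Rightarrow> 'a list set" where
  "words A k = {w. length w = k \<and> set w \<subseteq> A}"

end

theory Submission
  imports Defs "HOL-Library.FuncSet"
begin

text \<open>
  Both sets are finite, so it is enough to count them. There are \<open>(m + n)\<^sup>m\<^sup>-\<^sup>1 m\<^sup>n\<^sup>-\<^sup>1\<close>
  pairs of words, and the same number of spanning trees is found as follows.

  Root every tree at a fixed clique vertex \<open>r\<close>. A spanning tree is then the same thing as an
  acyclic map that sends each vertex other than \<open>r\<close> to its parent, a neighbour in the graph
  (\<open>bij_betw_parent_edges\<close>). In the split graph the parent of an independent vertex is a clique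
  vertex, and the parent of a clique vertex may be any other vertex.

  Acyclic maps are counted by eliminating vertices: once the value of a map at \<open>s\<close> is chosen,
  other than \<open>s\<close> itself, every arrow into \<open>s\<close> may be redirected to that value, and acyclicity does not change
  (\<open>ranked_bypass\<close>). Repeating this shows that among all maps from a finite set \<open>S\<close> to a
  nonempty finite set \<open>X\<close> of slots, where each slot lies at some vertex, the proportion of
  acyclic ones is the proportion of slots that lie outside \<open>S\<close> (\<open>card_ranked_slot_maps\<close>).

  For the split graph with clique \<open>C\<close> and independent set \<open>I\<close>, fix the parents
  \<open>g : I \<rightarrow> C\<close> first and eliminate \<open>I\<close>. A clique vertex other than \<open>r\<close> then chooses
  among \<open>m + n\<close> slots: every \<open>c \<in> C\<close> is a slot at \<open>c\<close>, and every \<open>i \<in> I\<close> is a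
  slot at \<open>g i\<close>. Hence \<open>g\<close> extends to \<open>(m + n)\<^sup>m\<^sup>-\<^sup>2\<close> trees for each slot at \<open>r\<close>.
  Summed over all \<open>g\<close>, the number of slots at \<open>r\<close> is
  \<open>m\<^sup>n + n m\<^sup>n\<^sup>-\<^sup>1 = (m + n) m\<^sup>n\<^sup>-\<^sup>1\<close> (\<open>sum_root_slots\<close>), which gives the count.
\<close>

section \<open>Acyclic maps and elimination of vertices\<close>

text \<open>
  This says that every orbit of \<open>f\<close> that starts in \<open>S\<close> leaves \<open>S\<close>; the number of steps
  this takes is a possible rank \<open>d\<close>. Stated with an arbitrary rank, acyclicity survives the
  redirection of arrows after a simple adjustment of \<open>d\<close>.
\<close>

definition ranked :: "'a set \<Rightarrow> ('a \<Rightarrow> 'a) \<Rightarrow> bool" where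
  "ranked S f \<longleftrightarrow> (\<exists>d :: 'a \<Rightarrow> nat. \<forall>v\<in>S. d (f v) < d v)"

lemma ranked_cong:
  assumes "\<And>v. v \<in> S \<Longrightarrow> f v = g v"
  shows "ranked S f \<longleftrightarrow> ranked S g"
  using assms by (simp add: ranked_def)

lemma ranked_neq: "ranked S f \<Longrightarrow> v \<in> S \<Longrightarrow> f v \<noteq> v"
  by (metis ranked_def less_irrefl)

text \<open>
  Elimination of the vertices in \<open>A\<close>. As \<open>f\<close> leaves \<open>A\<close> after one step, an orbit in
  \<open>A \<union> B\<close> and the orbit that skips its visits to \<open>A\<close> are finite or infinite together.
\<close>

lemma ranked_bypass:
  assumes "A \<inter> B = {}" and out: "\<And>v. v \<in> A \<Longrightarrow> f v \<notin> A"
  shows "ranked (A \<union> B) f \<longleftrightarrow> ranked B (\<lambda>v. if f v \<in> A then f (f v) else f v)"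
    (is "_ \<longleftrightarrow> ranked B ?f'")
proof
  assume "ranked (A \<union> B) f"
  then obtain d :: "'a \<Rightarrow> nat" where d: "\<And>v. v \<in> A \<union> B \<Longrightarrow> d (f v) < d v"
    by (auto simp: ranked_def)
  have "d (?f' v) < d v" if "v \<in> B" for v
    using d[of v] d[of "f v"] that by auto
  then show "ranked B ?f'"
    unfolding ranked_def by blast
next
  assume "ranked B ?f'"
  then obtain d :: "'a \<Rightarrow> nat" where d: "\<And>v. v \<in> B \<Longrightarrow> d (?f' v) < d v"
    unfolding ranked_def by blast
  \<comment> \<open>Doubling the ranks makes room for \<open>v \<in> A\<close> just above \<open>f v\<close>, and so below every \<open>u \<in> B\<close>
    with \<open>f u = v\<close>, as \<open>u\<close> already ranks above \<open>f v\<close>.\<close>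
  define d' where "d' v = (if v \<in> A then 2 * d (f v) + 1 else 2 * d v)" for v
  have "d' (f v) < d' v" if "v \<in> A \<union> B" for v
  proof (cases "v \<in> A")
    case True
    then show ?thesis using out by (simp add: d'_def)
  next
    case False
    then have "v \<in> B" using that by simp
    then show ?thesis using d[of v] False by (auto simp: d'_def split: if_splits)
  qed
  then show "ranked (A \<union> B) f"
    unfolding ranked_def by blast
qed

section \<open>Counting acyclic maps\<close>

text \<open>
  The elements of \<open>X\<close> are slots, and \<open>h\<close> tells at which vertex each of them lies. Letting
  \<open>h\<close> vary is what makes induction on \<open>S\<close> work: if \<open>s\<close> chooses the slot \<open>x\<close>, then
  eliminating \<open>s\<close> moves all slots at \<open>s\<close> to \<open>h x\<close> and keeps \<open>X\<close>. Write \<open>A\<close> for the slots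
  outside \<open>S \<union> {s}\<close> and \<open>B\<close> for those at \<open>s\<close>. The choices of \<open>x\<close> with
  \<open>h x \<noteq> s\<close> number \<open>|X| - |B|\<close>; each leaves the \<open>|A|\<close> slots outside, and those with
  \<open>x \<in> A\<close> add \<open>|B|\<close> further ones. The sum over \<open>x\<close> is
  \<open>(|X| - |B|) |A| + |A| |B| = |X| |A|\<close>. The factor \<open>|X|\<close> on the left avoids the exponent
  \<open>|S| - 1\<close>, which would be wrong for empty \<open>S\<close>.
\<close>

lemma card_ranked_slot_maps:
  assumes "finite S" and "finite X"
  shows "card {p \<in> S \<rightarrow>\<^sub>E X. ranked S (\<lambda>v. h (p v))} * card X
           = card {x \<in> X. h x \<notin> S} * card X ^ card S"
  using assms(1)
proof (induction S arbitrary: h rule: finite_induct)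
  case empty
  then show ?case by (simp add: ranked_def)
next
  case (insert s S)
  define k where "k x y = (if h y = s then h x else h y)" for x y
  define Q where "Q x = {q \<in> S \<rightarrow>\<^sub>E X. ranked S (\<lambda>v. k x (q v))}" for x
  let ?X = "{x \<in> X. h x \<noteq> s}"
  let ?A = "{x \<in> X. h x \<notin> insert s S}"
  let ?B = "{x \<in> X. h x = s}"
  have finS: "finite (S \<rightarrow>\<^sub>E X)"
    using insert.hyps assms(2) by (simp add: finite_PiE)
  have step: "ranked (insert s S) (\<lambda>v. h ((q(s := x)) v)) \<longleftrightarrow> h x \<noteq> s \<and> ranked S (\<lambda>v. k x (q v))"
    if "q \<in> S \<rightarrow>\<^sub>E X" for q x
  proof (cases "h x = s")
    case True
    then show ?thesis
      using ranked_neq[of "insert s S" "\<lambda>v. h ((q(s := x)) v)" s] by auto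
  next
    case False
    have "ranked ({s} \<union> S) (\<lambda>v. h ((q(s := x)) v)) \<longleftrightarrow> ranked S (\<lambda>v. k x (q v))"
      using insert.hyps False
      by (subst ranked_bypass) (auto simp: k_def intro!: ranked_cong)
    then show ?thesis using False by simp
  qed
  have "{p \<in> insert s S \<rightarrow>\<^sub>E X. ranked (insert s S) (\<lambda>v. h (p v))}
          = (\<lambda>(x, q). q(s := x)) ` (SIGMA x : ?X. Q x)"
    (is "?P = _")
  proof (intro equalityI subsetI)
    fix p assume p: "p \<in> ?P"
    then obtain x q where xq: "p = q(s := x)" "x \<in> X" "q \<in> S \<rightarrow>\<^sub>E X"
      by (auto simp: PiE_insert_eq)
    then have "(x, q) \<in> (SIGMA x : ?X. Q x)"
      using p step[OF xq(3)] by (simp add: Q_def)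
    then show "p \<in> (\<lambda>(x, q). q(s := x)) ` (SIGMA x : ?X. Q x)"
      by (rule rev_image_eqI) (simp add: xq(1))
  next
    fix p assume "p \<in> (\<lambda>(x, q). q(s := x)) ` (SIGMA x : ?X. Q x)"
    then obtain x q where "p = q(s := x)" "x \<in> X" "h x \<noteq> s" "q \<in> Q x"
      by auto
    then show "p \<in> ?P"
      using step[of q x] by (auto simp: Q_def PiE_insert_eq simp del: fun_upd_apply)
  qed
  moreover have "inj_on (\<lambda>(x, q). q(s := x)) (SIGMA x : ?X. Q x)"
    by (rule inj_on_subset[OF inj_combinator[of s S "\<lambda>_. X"]]) (use insert.hyps in \<open>auto simp: Q_def\<close>)
  ultimately have card_eq: "card {p \<in> insert s S \<rightarrow>\<^sub>E X. ranked (insert s S) (\<lambda>v. h (p v))}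
      = (\<Sum>x\<in>?X. card (Q x))"
    using assms(2) finS by (simp add: card_image Q_def)
  have IH: "card (Q x) * card X = card {y \<in> X. k x y \<notin> S} * card X ^ card S" for x
    unfolding Q_def by (rule insert.IH)
  have slots: "card {y \<in> X. k x y \<notin> S} = card ?A + (if h x \<notin> S then card ?B else 0)"
    if "x \<in> ?X" for x
  proof -
    have "{y \<in> X. k x y \<notin> S} = ?A \<union> (if h x \<notin> S then ?B else {})"
      using that by (auto simp: k_def)
    then show ?thesis
      using assms(2) by (auto intro!: card_Un_disjoint)
  qed
  have "(\<Sum>x\<in>?X. if h x \<notin> S then card ?B else 0) = card ?A * card ?B"
  proof -
    have "{x \<in> ?X. h x \<notin> S} = ?A" by auto
    then show ?thesis
      using assms(2) by (simp add: sum.inter_filter[symmetric])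
  qed
  then have "(\<Sum>x\<in>?X. card {y \<in> X. k x y \<notin> S}) = card ?X * card ?A + card ?A * card ?B"
    by (simp add: slots sum.distrib)
  moreover have "card X = card ?X + card ?B"
    using assms(2) by (subst card_Un_disjoint[symmetric]) (auto intro!: arg_cong[where f = card])
  ultimately have "(\<Sum>x\<in>?X. card {y \<in> X. k x y \<notin> S}) = card ?A * card X"
    by (simp add: algebra_simps)
  then have "(\<Sum>x\<in>?X. card (Q x)) * card X = card ?A * card X * card X ^ card S"
    unfolding sum_distrib_right IH by (simp only: flip: sum_distrib_right)
  then show ?case
    unfolding card_eq using insert.hyps by (simp add: mult.assoc)
qed

lemma card_maps_with_value:
  assumes "finite I" "finite C" "i \<in> I" "r \<in> C"
  shows "card {g \<in> I \<rightarrow>\<^sub>E C. g i = r} = card C ^ (card I - 1)"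
proof -
  have "{g \<in> I \<rightarrow>\<^sub>E C. g i = r} = (\<Pi>\<^sub>E j\<in>I. if j = i then {r} else C)"
    using assms by (fastforce simp: PiE_iff split: if_splits)
  then show ?thesis
    using assms by (simp add: card_PiE prod.remove[of I i])
qed

text \<open>
  Double counting of the pairs of a map \<open>g\<close> and a slot at \<open>r\<close>. The slot \<open>r\<close> itself counts for
  every \<open>g\<close>, no other slot in \<open>C\<close> ever counts, and a slot \<open>i \<in> I\<close> counts for those \<open>g\<close>
  with \<open>g i = r\<close>.
\<close>

lemma sum_root_slots:
  assumes "finite I" "finite C" "C \<inter> I = {}" "r \<in> C"
  shows "(\<Sum>g\<in>I \<rightarrow>\<^sub>E C. card {x \<in> C \<union> I. (if x \<in> I then g x else x) = r})
           = card C ^ card I + card I * card C ^ (card I - 1)"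
proof -
  let ?h = "\<lambda>g x. if x \<in> I then g x else x"
  let ?G = "I \<rightarrow>\<^sub>E C"
  have fin: "finite ?G" using assms by (simp add: finite_PiE)
  have "(\<Sum>g\<in>?G. card {x \<in> C \<union> I. ?h g x = r}) = (\<Sum>x\<in>C \<union> I. card {g \<in> ?G. ?h g x = r})"
    using sum.swap[of "\<lambda>g x. if ?h g x = r then 1 else 0" "C \<union> I" ?G]
    unfolding card_eq_sum sum.inter_filter[OF finite_UnI[OF assms(2,1)]] sum.inter_filter[OF fin] .
  also have "\<dots> = (\<Sum>x\<in>C. card {g \<in> ?G. ?h g x = r}) + (\<Sum>x\<in>I. card {g \<in> ?G. ?h g x = r})"
    using assms by (simp add: sum.union_disjoint)
  also have "(\<Sum>x\<in>C. card {g \<in> ?G. ?h g x = r}) = (\<Sum>x\<in>C. if x = r then card ?G else 0)"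
  proof (rule sum.cong)
    fix x assume "x \<in> C"
    then have "x \<notin> I" using assms(3) by auto
    then show "card {g \<in> ?G. ?h g x = r} = (if x = r then card ?G else 0)" by simp
  qed simp
  also have "\<dots> = card C ^ card I"
    using assms by (simp add: card_PiE)
  also have "(\<Sum>x\<in>I. card {g \<in> ?G. ?h g x = r}) = card I * card C ^ (card I - 1)"
    using assms by (simp add: card_maps_with_value)
  finally show ?thesis .
qed

text \<open>
  A parent map splits into its restrictions \<open>g\<close> to \<open>I\<close> and \<open>q\<close> to \<open>C - {r}\<close>. Since \<open>g\<close>
  maps into \<open>C\<close>, all of \<open>I\<close> can be eliminated at once, and \<open>q\<close> becomes a slot map on
  \<open>C - {r}\<close> in which \<open>i \<in> I\<close> is a slot at \<open>g i\<close>.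
\<close>

lemma card_ranked_split_maps:
  assumes "finite C" "finite I" "C \<inter> I = {}" "r \<in> C" "I \<noteq> {}"
  shows "card {f \<in> (\<Pi>\<^sub>E v\<in>C \<union> I - {r}. if v \<in> I then C else C \<union> I). ranked (C \<union> I - {r}) f}
           = card (C \<union> I) ^ (card C - 1) * card C ^ (card I - 1)"
    (is "card ?F = _")
proof -
  let ?V = "C \<union> I" and ?C' = "C - {r}" and ?G = "I \<rightarrow>\<^sub>E C"
  let ?h = "\<lambda>g x. if x \<in> I then g x else x"
  let ?Q = "\<lambda>g. {q \<in> ?C' \<rightarrow>\<^sub>E ?V. ranked ?C' (\<lambda>v. ?h g (q v))}"
  let ?split = "\<lambda>f. (restrict f I, restrict f ?C')"
  let ?join = "\<lambda>(g, q). \<lambda>v\<in>?V - {r}. if v \<in> I then g v else q v"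
  have V: "?V - {r} = I \<union> ?C'" using assms by auto
  have ranked_iff: "ranked (?V - {r}) f \<longleftrightarrow> ranked ?C' (\<lambda>v. ?h f (f v))"
    if "\<And>v. v \<in> I \<Longrightarrow> f v \<in> C" for f
    unfolding V using that assms(3) by (subst ranked_bypass) auto
  have "bij_betw ?split ?F (SIGMA g : ?G. ?Q g)"
  proof (rule bij_betw_byWitness[where f' = ?join])
    show "\<forall>f\<in>?F. ?join (?split f) = f"
      by (auto simp: fun_eq_iff PiE_iff extensional_def)
    show "\<forall>p\<in>SIGMA g : ?G. ?Q g. ?split (?join p) = p"
      using assms by (auto simp: fun_eq_iff PiE_iff extensional_def)
    show "?split ` ?F \<subseteq> (SIGMA g : ?G. ?Q g)"
    proof (rule image_subsetI)
      fix f assume "f \<in> ?F"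
      then have f: "f \<in> (\<Pi>\<^sub>E v\<in>?V - {r}. if v \<in> I then C else ?V)" and r: "ranked (?V - {r}) f"
        by auto
      have fI: "f v \<in> C" if "v \<in> I" for v
      proof -
        have "v \<in> C \<union> I - {r}" using that assms by auto
        then show ?thesis using PiE_mem[OF f, of v] that by simp
      qed
      have "restrict f I \<in> ?G" using fI by auto
      moreover have "f v \<in> ?V" if "v \<in> ?C'" for v
        using PiE_mem[OF f, of v] that by (auto split: if_splits)
      then have "restrict f ?C' \<in> ?C' \<rightarrow>\<^sub>E ?V" by auto
      moreover have "ranked ?C' (\<lambda>v. ?h f (f v))" using ranked_iff fI r by blast
      then have "ranked ?C' (\<lambda>v. ?h (restrict f I) (restrict f ?C' v))"
        by (rule ranked_cong[THEN iffD1, rotated]) auto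
      ultimately show "?split f \<in> (SIGMA g : ?G. ?Q g)" by simp
    qed
    show "?join ` (SIGMA g : ?G. ?Q g) \<subseteq> ?F"
    proof (rule image_subsetI)
      fix p assume "p \<in> (SIGMA g : ?G. ?Q g)"
      then obtain g q where p: "p = (g, q)" and g: "g \<in> ?G" and q: "q \<in> ?C' \<rightarrow>\<^sub>E ?V" and r: "ranked ?C' (\<lambda>v. ?h g (q v))"
        by blast
      let ?f = "?join (g, q)"
      have "ranked ?C' (\<lambda>v. ?h ?f (?f v))"
        using r by (rule ranked_cong[THEN iffD1, rotated]) (use assms in auto)
      moreover have "?f v \<in> C" if "v \<in> I" for v
        using that g assms by auto
      ultimately have "ranked (?V - {r}) ?f" using ranked_iff by blast
      moreover have "?f \<in> (\<Pi>\<^sub>E v\<in>?V - {r}. if v \<in> I then C else ?V)"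
        using g q by (auto simp: Pi_iff PiE_iff)
      ultimately show "?join p \<in> ?F" unfolding p by blast
    qed
  qed
  then have "card ?F = card (SIGMA g : ?G. ?Q g)"
    by (rule bij_betw_same_card)
  also have "\<dots> = (\<Sum>g\<in>?G. card (?Q g))"
    using assms(1,2) by (subst card_SigmaI) (auto simp: finite_PiE)
  finally have "card ?F * card ?V = (\<Sum>g\<in>?G. card (?Q g) * card ?V)"
    by (simp add: sum_distrib_right)
  also have "\<dots> = (\<Sum>g\<in>?G. card {x \<in> ?V. ?h g x = r} * card ?V ^ (card C - 1))"
  proof (rule sum.cong)
    fix g assume g: "g \<in> ?G"
    have "{x \<in> ?V. ?h g x \<notin> ?C'} = {x \<in> ?V. ?h g x = r}"
      using g assms by auto
    then show "card (?Q g) * card ?V = card {x \<in> ?V. ?h g x = r} * card ?V ^ (card C - 1)"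
      using card_ranked_slot_maps[of ?C' ?V "?h g"] assms by simp
  qed simp
  also have "\<dots> = (card C ^ card I + card I * card C ^ (card I - 1)) * card ?V ^ (card C - 1)"
    using sum_root_slots[OF assms(2,1,3,4)] by (simp flip: sum_distrib_right)
  also have "card C ^ card I = card C * card C ^ (card I - 1)"
    using assms by (metis card_gt_0_iff power_minus_mult mult.commute)
  also have "(card C * card C ^ (card I - 1) + card I * card C ^ (card I - 1)) * card ?V ^ (card C - 1)
      = (card ?V ^ (card C - 1) * card C ^ (card I - 1)) * card ?V"
    using assms by (simp add: card_Un_disjoint algebra_simps)
  finally have "card ?F * card ?V = (card ?V ^ (card C - 1) * card C ^ (card I - 1)) * card ?V" .
  moreover have "card ?V \<noteq> 0" using assms by auto
  ultimately show ?thesis by simp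
qed

section \<open>Spanning trees and parent maps\<close>

lemma graph_cycle_two_neighbours:
  assumes "graph_cycle E c" and "x \<in> set c"
  obtains y z where "y \<in> set c" "z \<in> set c" "y \<noteq> z" "{x, y} \<in> E" "{x, z} \<in> E"
proof -
  have c: "3 \<le> length c" "distinct c" "{last c, hd c} \<in> E"
    and succ: "\<And>i. Suc i < length c \<Longrightarrow> {c ! i, c ! Suc i} \<in> E"
    using assms(1) by (auto simp: graph_cycle_def)
  obtain i where i: "i < length c" "x = c ! i"
    using assms(2) by (metis in_set_conv_nth)
  define a where "a = (if i = 0 then length c - 1 else i - 1)"
  define b where "b = (if Suc i = length c then 0 else Suc i)"
  have wrap: "{c ! (length c - 1), c ! 0} \<in> E"
    using c by (metis hd_conv_nth last_conv_nth list.size(3) not_numeral_le_zero)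
  have len: "a < length c" "b < length c" "a \<noteq> b"
    using i c(1) by (auto simp: a_def b_def)
  show ?thesis
  proof
    show "c ! a \<in> set c" "c ! b \<in> set c" using len by auto
    show "c ! a \<noteq> c ! b" using len c(2) by (simp add: nth_eq_iff_index_eq)
    show "{x, c ! a} \<in> E"
      using wrap succ[of "i - 1"] i by (auto simp: a_def insert_commute)
    show "{x, c ! b} \<in> E"
    proof (cases "Suc i = length c")
      case True
      then have "i = length c - 1" by simp
      then show ?thesis using wrap i True by (simp add: b_def)
    qed (use succ[of i] i in \<open>simp add: b_def\<close>)
  qed
qed

text \<open>
  When a path is extended to the front by a vertex that it already visits, the part before that
  visit is dropped.
\<close>

lemma rtrancl_distinct_path:
  assumes "(u, v) \<in> R\<^sup>*"
  obtains c where "c \<noteq> []" "hd c = u" "last c = v" "distinct c" "successively (\<lambda>x y. (x, y) \<in> R) c"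
proof -
  have "\<exists>c. c \<noteq> [] \<and> hd c = u \<and> last c = v \<and> distinct c \<and> successively (\<lambda>x y. (x, y) \<in> R) c"
    using assms
  proof (induction rule: converse_rtrancl_induct)
    case base
    show ?case by (rule exI[of _ "[v]"]) simp
  next
    case (step y z)
    then obtain c where c: "c \<noteq> []" "hd c = z" "last c = v" "distinct c"
      "successively (\<lambda>x y. (x, y) \<in> R) c" by blast
    show ?case
    proof (cases "y \<in> set c")
      case True
      then obtain as bs where "c = as @ y # bs" by (metis split_list)
      with c show ?thesis
        by (intro exI[of _ "y # bs"]) (auto simp: successively_append_iff)
    next
      case False
      with c step.hyps show ?thesis
        by (intro exI[of _ "y # c"]) (auto simp: successively_Cons)
    qed
  qed
  then show thesis using that by blast
qed

text \<open>
  A simple path in \<open>E'\<close> from \<open>u\<close> to \<open>v\<close> is closed up by the edge \<open>{u, v}\<close>. It has at least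
  three vertices because \<open>{u, v}\<close> is not in \<open>E'\<close>.
\<close>

lemma graph_cycle_of_chord:
  assumes "(u, v) \<in> {(x, y). {x, y} \<in> E'}\<^sup>*" "E' \<subseteq> E" "{u, v} \<in> E" "{u, v} \<notin> E'" "u \<noteq> v"
  shows "\<exists>c. graph_cycle E c"
proof -
  obtain c where c: "c \<noteq> []" "hd c = u" "last c = v" "distinct c"
    and "successively (\<lambda>x y. (x, y) \<in> {(x, y). {x, y} \<in> E'}) c"
    using rtrancl_distinct_path[OF assms(1)] by blast
  then have path: "\<And>i. Suc i < length c \<Longrightarrow> {c ! i, c ! Suc i} \<in> E'"
    by (auto simp: successively_conv_nth)
  have "length c \<noteq> 0" "length c \<noteq> 1" "length c \<noteq> 2"
    using c path[of 0] assms(4,5) by (auto simp: length_Suc_conv numeral_2_eq_2)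
  then have "3 \<le> length c" by linarith
  then have "graph_cycle E c"
    using c path assms(2,3) by (auto simp: graph_cycle_def insert_commute)
  then show ?thesis ..
qed

definition parent_edges :: "'a set \<Rightarrow> ('a \<Rightarrow> 'a) \<Rightarrow> 'a set set" where
  "parent_edges S f = (\<lambda>v. {v, f v}) ` S"

lemma connected_parent_edges:
  assumes "ranked (V - {r}) f" "r \<in> V" "f ` (V - {r}) \<subseteq> V"
  shows "connected_graph V (parent_edges (V - {r}) f)"
proof -
  let ?R = "{(x, y). {x, y} \<in> parent_edges (V - {r}) f}"
  obtain d :: "'a \<Rightarrow> nat" where d: "\<And>v. v \<in> V - {r} \<Longrightarrow> d (f v) < d v"
    using assms(1) by (auto simp: ranked_def)
  have to_r: "(v, r) \<in> ?R\<^sup>*" if "v \<in> V" for v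
    using that
  proof (induction "d v" arbitrary: v rule: less_induct)
    case less
    show ?case
    proof (cases "v = r")
      case False
      then have v: "v \<in> V - {r}" using less.prems by simp
      then have "(f v, r) \<in> ?R\<^sup>*"
        using less.hyps d assms(3) by blast
      moreover have "(v, f v) \<in> ?R" using v by (auto simp: parent_edges_def)
      ultimately show ?thesis by (rule converse_rtrancl_into_rtrancl[rotated])
    qed simp
  qed
  have "sym ?R" by (auto simp: sym_def insert_commute)
  then have "sym (?R\<^sup>*)" by (rule sym_rtrancl)
  then have "(u, v) \<in> ?R\<^sup>*" if "u \<in> V" "v \<in> V" for u v
    using to_r[OF that(1)] to_r[OF that(2)] by (meson symD rtrancl_trans)
  then show ?thesis
    using assms(2) by (auto simp: connected_graph_def)
qed

text \<open>
  A vertex of maximal rank on a cycle is not the parent of another vertex on it, so both of its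
  neighbours on the cycle would have to be its own parent.
\<close>

lemma no_graph_cycle_parent_edges:
  assumes "ranked S f"
  shows "\<not> graph_cycle (parent_edges S f) c"
proof
  assume cyc: "graph_cycle (parent_edges S f) c"
  obtain d :: "'a \<Rightarrow> nat" where d: "\<And>v. v \<in> S \<Longrightarrow> d (f v) < d v"
    using assms by (auto simp: ranked_def)
  have "set c \<noteq> {}" using cyc by (auto simp: graph_cycle_def)
  then obtain x where x: "x \<in> set c" "\<And>y. y \<in> set c \<Longrightarrow> d y \<le> d x"
    using finite_has_maximal[of "d ` set c"]
    by (metis (no_types, lifting) Max_ge Max_in finite_imageI finite_set image_iff image_is_empty)
  have "y = f x" if "y \<in> set c" "{x, y} \<in> parent_edges S f" for y
    using that x(2)[of y] d by (fastforce simp: parent_edges_def doubleton_eq_iff)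
  then show False
    using graph_cycle_two_neighbours[OF cyc x(1)] by metis
qed

text \<open>
  The edge \<open>{v, f v}\<close> can be read by \<open>g\<close> only as \<open>g v = f v\<close> or as \<open>g (f v) = v\<close>. By
  induction on the rank, the second reading gives \<open>f (f v) = v\<close>, a cycle of \<open>f\<close>.
\<close>

lemma parent_edges_determine:
  assumes "ranked S f" "parent_edges S f = parent_edges S g" "v \<in> S"
  shows "g v = f v"
proof -
  obtain d :: "'a \<Rightarrow> nat" where d: "\<And>v. v \<in> S \<Longrightarrow> d (f v) < d v"
    using assms(1) by (auto simp: ranked_def)
  show ?thesis
    using assms(3)
  proof (induction "d v" arbitrary: v rule: less_induct)
    case less
    have "{v, f v} \<in> parent_edges S g"
      using less.prems assms(2) by (auto simp: parent_edges_def)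
    then consider "g v = f v" | "f v \<in> S" "g (f v) = v"
      by (auto simp: parent_edges_def doubleton_eq_iff)
    then show ?case
    proof cases
      case 2
      then have "f (f v) = v" using less d by metis
      then show ?thesis using d[of v] d[of "f v"] 2 less.prems by simp
    qed
  qed
qed

text \<open>
  Let \<open>f\<close> send each vertex to a neighbour that is closer to the root. The edges of \<open>f\<close> already
  connect \<open>V\<close>, so any further edge of the tree would close a cycle.
\<close>

lemma tree_has_parent_map:
  assumes "is_tree V T" "r \<in> V"
  obtains f where "ranked (V - {r}) f" "parent_edges (V - {r}) f = T"
proof -
  let ?R = "{(x, y). {x, y} \<in> T}" and ?S = "V - {r}"
  define d where "d v = (LEAST k. (v, r) \<in> ?R ^^ k)" for v
  have conn: "\<And>v. v \<in> V \<Longrightarrow> (v, r) \<in> ?R\<^sup>*" and simple: "simple_graph V T"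
    and acyc: "\<nexists>c. graph_cycle T c"
    using assms by (auto simp: is_tree_def connected_graph_def)
  have "\<exists>u. {v, u} \<in> T \<and> d u < d v" if v: "v \<in> ?S" for v
  proof -
    obtain k where "(v, r) \<in> ?R ^^ k" using conn v rtrancl_power by blast
    then have dv: "(v, r) \<in> ?R ^^ d v" unfolding d_def by (rule LeastI)
    moreover have "d v \<noteq> 0"
    proof
      assume "d v = 0"
      with dv v show False by simp
    qed
    then obtain j where j: "d v = Suc j" using not0_implies_Suc by blast
    ultimately obtain u where u: "(v, u) \<in> ?R" "(u, r) \<in> ?R ^^ j"
      by (metis relpow_Suc_D2)
    then have "d u \<le> j" unfolding d_def by (intro Least_le)
    then show ?thesis using u j by auto
  qed
  then obtain f where f: "\<And>v. v \<in> ?S \<Longrightarrow> {v, f v} \<in> T \<and> d (f v) < d v" by metis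
  then have rk: "ranked ?S f" by (auto simp: ranked_def)
  have sub: "parent_edges ?S f \<subseteq> T" using f by (auto simp: parent_edges_def)
  have "f ` ?S \<subseteq> V"
    using f simple by (fastforce simp: simple_graph_def doubleton_eq_iff)
  then have conn': "connected_graph V (parent_edges ?S f)"
    using rk assms(2) by (intro connected_parent_edges)
  have "e \<in> parent_edges ?S f" if e: "e \<in> T" for e
  proof (rule ccontr)
    assume new: "e \<notin> parent_edges ?S f"
    obtain u v where uv: "u \<in> V" "v \<in> V" "u \<noteq> v" "e = {u, v}"
      using simple e by (auto simp: simple_graph_def)
    then have "(u, v) \<in> {(x, y). {x, y} \<in> parent_edges ?S f}\<^sup>*"
      using conn' by (auto simp: connected_graph_def)
    then show False
      using graph_cycle_of_chord[OF _ sub] acyc e new uv by blast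
  qed
  with sub have "parent_edges ?S f = T" by blast
  with rk show thesis using that by blast
qed

lemma bij_betw_parent_edges:
  assumes "simple_graph V E" "r \<in> V"
  shows "bij_betw (parent_edges (V - {r}))
           {f \<in> (\<Pi>\<^sub>E v\<in>V - {r}. {u. {v, u} \<in> E}). ranked (V - {r}) f} (spanning_trees V E)"
    (is "bij_betw _ ?F _")
proof -
  let ?S = "V - {r}"
  have "inj_on (parent_edges ?S) ?F"
  proof (rule inj_onI)
    fix f g assume "f \<in> ?F" "g \<in> ?F" "parent_edges ?S f = parent_edges ?S g"
    then show "f = g"
      using parent_edges_determine[of ?S f g] by (intro PiE_ext[of f ?S _ g]) auto
  qed
  moreover have "parent_edges ?S f \<in> spanning_trees V E" if f: "f \<in> ?F" for f
  proof -
    have sub: "parent_edges ?S f \<subseteq> E"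
      using f by (auto simp: parent_edges_def PiE_iff)
    have "f ` ?S \<subseteq> V"
      using f assms(1) by (fastforce simp: simple_graph_def doubleton_eq_iff PiE_iff)
    then have "connected_graph V (parent_edges ?S f)"
      using f assms(2) by (intro connected_parent_edges) auto
    moreover have "simple_graph V (parent_edges ?S f)"
      using sub assms(1) by (auto simp: simple_graph_def)
    ultimately show ?thesis
      using sub no_graph_cycle_parent_edges f by (auto simp: spanning_trees_def is_tree_def)
  qed
  moreover have "T \<in> parent_edges ?S ` ?F" if T: "T \<in> spanning_trees V E" for T
  proof -
    have "is_tree V T" "T \<subseteq> E" using T by (auto simp: spanning_trees_def)
    then obtain f where f: "ranked ?S f" "parent_edges ?S f = T"
      using tree_has_parent_map assms(2) by metis
    have "restrict f ?S \<in> ?F"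
      using f \<open>T \<subseteq> E\<close> ranked_cong[of ?S f "restrict f ?S"]
      by (auto simp: parent_edges_def)
    moreover have "parent_edges ?S (restrict f ?S) = T"
      using f(2) by (auto simp: parent_edges_def)
    ultimately show ?thesis by blast
  qed
  ultimately show ?thesis by (auto simp: bij_betw_def)
qed

section \<open>Spanning trees of the complete split graph\<close>

lemma card_words:
  assumes "finite A"
  shows "card (words A k) = card A ^ k" "finite (words A k)"
  using card_lists_length_eq[OF assms, of k] finite_lists_length_eq[OF assms, of k]
  by (simp_all add: words_def conj_commute)

lemma split_edges_iff:
  "{v, u} \<in> split_edges m n \<longleftrightarrow>
     v \<noteq> u \<and> v \<in> {1..m + n} \<and> u \<in> {1..m + n} \<and> (v \<in> {1..m} \<or> u \<in> {1..m})"
    (is "?l \<longleftrightarrow> ?r")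
proof
  show "?l \<Longrightarrow> ?r"
    unfolding split_edges_def by (auto simp: doubleton_eq_iff)
next
  assume r: ?r
  have uv: "{v, u} = {u, v}" by (rule insert_commute)
  from r consider "v \<in> {1..m}" "u \<in> {1..m}" | "v \<in> {1..m}" "u \<in> {m + 1..m + n}"
    | "u \<in> {1..m}" "v \<in> {m + 1..m + n}"
    by force
  then show ?l
  proof cases
    case 1
    then show ?thesis using r unfolding split_edges_def by blast
  next
    case 2
    then show ?thesis unfolding split_edges_def by blast
  next
    case 3
    then show ?thesis unfolding split_edges_def uv by blast
  qed
qed

lemma simple_graph_split: "simple_graph (split_verts m n) (split_edges m n)"
proof -
  have "\<exists>v u. e = {v, u}" if "e \<in> split_edges m n" for e
    using that unfolding split_edges_def by blast
  then show ?thesis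
    unfolding simple_graph_def split_verts_def by (metis split_edges_iff)
qed

lemma card_spanning_trees_split:
  assumes "m \<ge> 1" and "n \<ge> 1"
  shows "card (spanning_trees (split_verts m n) (split_edges m n)) = (m + n) ^ (m - 1) * m ^ (n - 1)"
proof -
  let ?C = "{1..m}" and ?I = "{m + 1..m + n}"
  have V: "split_verts m n = ?C \<union> ?I" by (auto simp: split_verts_def)
  let ?F = "{f \<in> (\<Pi>\<^sub>E v\<in>?C \<union> ?I - {1}. {u. {v, u} \<in> split_edges m n}). ranked (?C \<union> ?I - {1}) f}"
  let ?F' = "{f \<in> (\<Pi>\<^sub>E v\<in>?C \<union> ?I - {1}. if v \<in> ?I then ?C else ?C \<union> ?I). ranked (?C \<union> ?I - {1}) f}"
  \<comment> \<open>The target sets of \<open>?F'\<close> include \<open>v\<close> itself when \<open>v\<close> is a clique vertex; a ranked map never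
    uses that value.\<close>
  have "f \<in> ?F \<longleftrightarrow> f \<in> ?F'" for f
  proof (cases "ranked (?C \<union> ?I - {1}) f")
    case True
    then have "f v \<in> {u. {v, u} \<in> split_edges m n} \<longleftrightarrow> f v \<in> (if v \<in> ?I then ?C else ?C \<union> ?I)"
      if "v \<in> ?C \<union> ?I - {1}" for v
      using that ranked_neq[OF True that] by (auto simp: split_edges_iff)
    then show ?thesis by (simp add: PiE_iff)
  qed simp
  then have "?F = ?F'" by blast
  moreover have "card (spanning_trees (split_verts m n) (split_edges m n)) = card ?F"
    using bij_betw_parent_edges[OF simple_graph_split, of 1 m n] assms
    by (simp add: V bij_betw_same_card)
  moreover have "card ?F' = card (?C \<union> ?I) ^ (card ?C - 1) * card ?C ^ (card ?I - 1)"
    using assms by (intro card_ranked_split_maps) auto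
  moreover have "card (?C \<union> ?I) = m + n"
    by (subst card_Un_disjoint) auto
  ultimately show ?thesis by simp
qed

theorem proposition3p8:
  fixes m n :: nat
  assumes "m \<ge> 1" and "n \<ge> 1"
  shows "\<exists>\<phi>. bij_betw \<phi> (spanning_trees (split_verts m n) (split_edges m n))
               (words {1..m + n} (m - 1) \<times> words {1..m} (n - 1))"
proof (rule finite_same_card_bij)
  have "split_edges m n \<subseteq> Pow {1..m + n}"
    by (auto simp: split_edges_def)
  then have "finite (split_edges m n)"
    by (rule finite_subset) simp
  moreover have "spanning_trees (split_verts m n) (split_edges m n) \<subseteq> Pow (split_edges m n)"
    by (auto simp: spanning_trees_def)
  ultimately show "finite (spanning_trees (split_verts m n) (split_edges m n))"
    by (simp add: finite_subset)
  show "finite (words {1..m + n} (m - 1) \<times> words {1..m} (n - 1))"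
    by (simp add: card_words)
  show "card (spanning_trees (split_verts m n) (split_edges m n))
      = card (words {1..m + n} (m - 1) \<times> words {1..m} (n - 1))"
    using card_spanning_trees_split[OF assms] by (simp add: card_words card_cartesian_product)
qed

end
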